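(* Let $\Sigma=(\mathcal A,\mathcal A_1,\mathcal G,E,X,U,h)$ be a dt-SNPS-td with input set $U=\{u\in\mathbb R^m\mid b_j^\top u\le1,\ j=1,\dots,J\}$, $b_j\in\mathbb R^m$. Let the state set $X$, initial set $X_a\subset X$ and unsafe set $X_b\subset X$ be given by vectors of polynomial inequalities $X=\{x\in\mathbb R^n\mid\mathcal J(x)\ge0\}$, $X_a=\{x\in\mathbb R^n\mid\mathcal J_a(x)\ge0\}$, $X_b=\{x\in\mathbb R^n\mid\mathcal J_b(x)\ge0\}$. Let there exist an SOS polynomial $\mathcal B(\mathbf x)=g(x)+\sum_{i=1}^h\tilde g(x_i)$ with $g,\tilde g$ polynomials, constants $\gamma_a,\gamma_b,\eta\in\mathbb R^+$ with $\gamma_b>\gamma_a$, and polynomials $\mathcal Y_{u_q}(x,x_h)$, $q=1,\dots,m$, corresponding to the $q$-th input in $u=[u_1;\dots;u_m]\in U$, with $\mathcal Y_u(x,x_h)=[\mathcal Y_{u_1}(x,x_h);\dots;\mathcal Y_{u_m}(x,x_h)]$. Suppose there exist (vectors of) SOS polynomials $\tilde{\mathcal Y}_j(x,x_h,u)$, $\mathcal Y_j(x,x_h)$, $\mathcal Y_{h_j}(x,x_h)$ ($j=1,\dots,J$), $\mathcal Y_a(x)$, $\bar{\mathcal Y}_a(\bar x)$, $\mathcal Y_b(x)$, $\bar{\mathcal Y}_b(\bar x)$, $\mathcal Y(x,x_h,u)$, $\mathcal Y_h(x,x_h,u)$ of appropriate dimensions such that the following expressions are all SOS polynomials: $$-g(x)-h\,\tilde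 g(\bar x)-\mathcal Y_a^\top(x)\mathcal J_a(x)-\bar{\mathcal Y}_a^\top(\bar x)\mathcal J_a(\bar x)+\gamma_a,$$ $$g(x)+h\,\tilde g(\bar x)-\mathcal Y_b^\top(x)\mathcal J_b(x)-\bar{\mathcal Y}_b^\top(\bar x)\big(\mathcal J(\bar x)-\mathcal J_b(\bar x)\big)-\gamma_b,$$ $$\begin{aligned}&-\mathbb E\big[g(\mathcal Ax+\mathcal A_1x_h+\mathcal Gu+Ew)\,\big|\,\mathbf x,u\big]+\eta+g(x)-\tilde g(x)+\tilde g(x_h)-\sum_{q=1}^m\big(u_q-\mathcal Y_{u_q}(x,x_h)\big)\\&\quad-\mathcal Y^\top(x,x_h,u)\mathcal J(x)-\mathcal Y_h^\top(x,x_h,u)\mathcal J(x_h)-\sum_{j=1}^J(1-b_j^\top u)\,\tilde{\mathcal Y}_j(x,x_h,u),\end{aligned}$$ $$1-b_j^\top\mathcal Y_u(x,x_h)-\mathcal Y_j^\top(x,x_h)\mathcal J(x)-\mathcal Y_{h_j}^\top(x,x_h)\mathcal J(x_h),\quad j=1,\dots,J.$$ Then $\mathcal B(\mathbf x)=g(x)+\sum_{i=1}^h\tilde g(x_i)$ satisfies (i) $\mathcal B(\mathbf x)\le\gamma_a$ for all $\mathbf x\in X_a^{h+1}$; (ii) $\mathcal B(\mathbf x)\ge\gamma_b$ for all $\mathbf x\in X_b\times(X\setminus X_b)^h$; (iii) for all $\mathbf x\in X^{h+1}$ there exists $u\in U$ such that $\mathbb E[\mathcal B(\mathbf x_{k+1})\mid\mathbf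 x_k=\mathbf x,u_k=u]-\mathcal B(\mathbf x)\le\eta$; and $u=[\mathcal Y_{u_1}(x,x_h);\dots;\mathcal Y_{u_m}(x,x_h)]$ is the corresponding safety controller, i.e. it takes values in $U$ for $(x,x_h)\in X^2$ and realizes (iii).
   Context: $\mathbb R^+$ denotes the positive reals. $[a;b;\dots]$ is vertical concatenation; vector inequalities are componentwise; SOS means sum of squares of polynomials. A discrete-time stochastic nonlinear polynomial system with time-invariant delay (dt-SNPS-td) $\Sigma=(\mathcal A,\mathcal A_1,\mathcal G,E,X,U,h)$ is $$x_{k+1}=A(x_k,x_{k-h})x_k+A_1(x_k,x_{k-h})x_{k-h}+G(x_k,x_{k-h})u_k+Ew_k,\quad k\in\mathbb N,$$ where $h\in\mathbb N^+$ is the delay; $x_k,x_{k-h}\in X\subseteq\mathbb R^n$; $u_k\in U$; $(w_k)$ are i.i.d. with standard normal distribution $\mathcal N(\mathbf 0,\mathbf I_n)$; $A(\cdot,\cdot),A_1(\cdot,\cdot)\in\mathbb R^{n\times n}$ and $G(\cdot,\cdot)\in\mathbb R^{n\times m}$ are polynomial matrices and $E\in\mathbb R^{n\times n}$ is constant. Abbreviations: $\mathcal A=A(x,x_h)$, $\mathcal A_1=A_1(x,x_h)$, $\mathcal G=G(x,x_h)$. The state history at time $k$ is $\mathbf x_k=(x_k,x_{k-1},\dots,x_{k-h})\in X^{h+1}$, with successor $\mathbf x_{k+1}=(x_{k+1},x_k,\dots,x_{k-h+1})$; a generic history is written $\mathbf x=(x,x_1,\dots,x_h)$, with $x$ the current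 and $x_h$ the $h$-step delayed state. Conditional expectations are over $w=w_k\sim\mathcal N(\mathbf 0,\mathbf I_n)$, with $x_{k+1}$ given by the dynamics and $\mathcal B$ evaluated through its formula; in the SOS expressions $u\in\mathbb R^m$ is treated as an independent symbolic variable. A function $\mathcal B(\mathbf x)=g(x)+\sum_{i=1}^h\tilde g(x_i)$, nonnegative with $g,\tilde g$ polynomials, satisfying (i)–(iii) is called a Krasovskii polynomial control barrier certificate (K-PCBC). The vectors $\mathcal J$ and $\mathcal J_b$ have the same number of components, so that $\mathcal J(\bar x)-\mathcal J_b(\bar x)$ is defined.
   Formalization: Conclusion (ii) is stated under the added condition that J(x) − J_b(x) ≥ 0 for every x in X∖X_b (automatic for one component); without it (ii) can fail when J and J_b have several components. *)

theory Defs
  imports "HOL-Probability.Probability"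
begin

text \<open>
  Real polynomials in the components of vectors are identified with the polynomial functions
  they induce (faithful, as the coefficient field is infinite).  Expressions in several vector
  variables, such as \<open>(x, x\<^sub>h, u)\<close>, are functions on a product space.
\<close>

definition sum_of_squares :: "(('a \<Rightarrow> real) \<Rightarrow> bool) \<Rightarrow> ('a \<Rightarrow> real) \<Rightarrow> bool" where
  "sum_of_squares P f \<longleftrightarrow> (\<exists>ps. (\<forall>p\<in>set ps. P p) \<and> (\<forall>x. f x = (\<Sum>p\<leftarrow>ps. (p x)\<^sup>2)))"

definition sos :: "('a::real_normed_vector \<Rightarrow> real) \<Rightarrow> bool" where
  "sos = sum_of_squares real_polynomial_function"

definition sos_vec :: "('a::real_normed_vector \<Rightarrow> real ^ 'k) \<Rightarrow> bool" where
  "sos_vec F \<longleftrightarrow> (\<forall>i. sos (\<lambda>x. F x $ i))"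

text \<open>
  A history \<open>(x, x\<^sub>1, \<dots>, x\<^sub>h)\<close> is a function on \<open>nat\<close>, \<open>x i\<close> being the state \<open>i\<close> steps ago; only the
  values at \<open>i \<le> h\<close> matter.  The successor history, with new state \<open>y\<close>, is \<open>case_nat y x\<close>.
  As \<open>nat \<Rightarrow> real ^ 'n\<close> is not a normed space, polynomials in a history get their own inductive
  definition, analogous to \<^const>\<open>real_polynomial_function\<close>.
\<close>

inductive history_polynomial :: "nat \<Rightarrow> ((nat \<Rightarrow> real ^ 'n) \<Rightarrow> real) \<Rightarrow> bool" for h where
  coord: "i \<le> h \<Longrightarrow> history_polynomial h (\<lambda>x. x i $ q)"
| const: "history_polynomial h (\<lambda>x. c)"
| add: "history_polynomial h p \<Longrightarrow> history_polynomial h r \<Longrightarrow> history_polynomial h (\<lambda>x. p x + r x)"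
| mult: "history_polynomial h p \<Longrightarrow> history_polynomial h r \<Longrightarrow> history_polynomial h (\<lambda>x. p x * r x)"

definition sos_history :: "nat \<Rightarrow> ((nat \<Rightarrow> real ^ 'n) \<Rightarrow> real) \<Rightarrow> bool" where
  "sos_history h = sum_of_squares (history_polynomial h)"

record ('n, 'm) dt_snps_td =
  mat_A  :: "(real ^ 'n) \<times> (real ^ 'n) \<Rightarrow> real ^ 'n ^ 'n"
  mat_A1 :: "(real ^ 'n) \<times> (real ^ 'n) \<Rightarrow> real ^ 'n ^ 'n"
  mat_G  :: "(real ^ 'n) \<times> (real ^ 'n) \<Rightarrow> real ^ 'm ^ 'n"
  mat_E  :: "real ^ 'n ^ 'n"
  states :: "(real ^ 'n) set"
  inputs :: "(real ^ 'm) set"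
  delay  :: nat

definition is_dt_snps_td :: "('n::finite, 'm::finite) dt_snps_td \<Rightarrow> bool" where
  "is_dt_snps_td S \<longleftrightarrow>
     polynomial_function (mat_A S) \<and> polynomial_function (mat_A1 S) \<and>
     polynomial_function (mat_G S) \<and> delay S \<ge> 1"

definition next_state ::
  "('n::finite, 'm::finite) dt_snps_td \<Rightarrow> real ^ 'n \<Rightarrow> real ^ 'n \<Rightarrow> real ^ 'm \<Rightarrow> real ^ 'n \<Rightarrow> real ^ 'n" where
  "next_state S x xh u w =
     mat_A S (x, xh) *v x + mat_A1 S (x, xh) *v xh + mat_G S (x, xh) *v u + mat_E S *v w"

text \<open>The law \<open>\<N>(0, I\<^sub>n)\<close>: a random vector with independent standard normal components.\<close>

definition std_normal_vec :: "(real ^ 'n) measure" where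
  "std_normal_vec =
     distr (\<Pi>\<^sub>M i\<in>(UNIV :: 'n set). density lborel (\<lambda>t. ennreal (std_normal_density t))) borel
       (\<lambda>w. \<chi> i. w i)"

definition barrier ::
  "nat \<Rightarrow> (real ^ 'n \<Rightarrow> real) \<Rightarrow> (real ^ 'n \<Rightarrow> real) \<Rightarrow> (nat \<Rightarrow> real ^ 'n) \<Rightarrow> real" where
  "barrier h g gt x = g (x 0) + (\<Sum>i=1..h. gt (x i))"

text \<open>\<open>\<E>[\<B>(\<^bold>x\<^sub>k\<^sub>+\<^sub>1) | \<^bold>x\<^sub>k = \<^bold>x, u\<^sub>k = u]\<close>\<close>

definition expected_barrier ::
  "('n::finite, 'm::finite) dt_snps_td \<Rightarrow> (real ^ 'n \<Rightarrow> real) \<Rightarrow> (real ^ 'n \<Rightarrow> real) \<Rightarrow>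
   (nat \<Rightarrow> real ^ 'n) \<Rightarrow> real ^ 'm \<Rightarrow> real" where
  "expected_barrier S g gt x u =
     (\<integral>w. barrier (delay S) g gt (case_nat (next_state S (x 0) (x (delay S)) u w) x) \<partial>std_normal_vec)"

end

theory Submission
  imports Defs
begin

text \<open>
  On \<open>X\<close> the multipliers of \<open>\<J>\<close> contribute nonnegative terms, so each SOS certificate yields a
  pointwise inequality.  The initial and unsafe certificates bound \<open>g x + h * gt x\<^sub>i\<close> for every single
  delayed state \<open>x\<^sub>i\<close>; averaging over \<open>i\<close> gives the bounds on the barrier.  In the decrease certificate the
  slack \<open>u\<^sub>q - \<Y>\<^sub>q\<close> vanishes for the proposed controller, which is admissible by the input
  certificate, and the sum of the \<open>gt x\<^sub>i\<close> telescopes along the shift of the history.  Splitting the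
  conditional expectation requires that polynomials are integrable for the Gaussian noise.
\<close>

lemma sum_of_squares_nonneg:
  assumes "sum_of_squares P f"
  shows "f x \<ge> 0"
  using assms by (auto simp: sum_of_squares_def intro!: sum_list_nonneg)

lemmas sos_nonneg = sum_of_squares_nonneg[where P = real_polynomial_function, folded sos_def]

lemma sos_vec_inner_nonneg:
  assumes "sos_vec F" "v \<ge> 0"
  shows "F x \<bullet> v \<ge> 0"
  using assms sos_nonneg[of "\<lambda>x. F x $ i" x for i]
  by (auto simp: sos_vec_def inner_vec_def less_eq_vec_def intro!: sum_nonneg)

section \<open>Functions with all powers integrable\<close>

text \<open>Having all powers integrable is the invariant carried through the polynomial induction.
  For sums, \<open>(a + b) ^ k\<close> is dominated by bounding both summands by the larger
  one.\<close>

lemma integrable_all_powers_add: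
  fixes f g :: "'a \<Rightarrow> real"
  assumes "\<And>k. integrable M (\<lambda>x. f x ^ k)" "\<And>k. integrable M (\<lambda>x. g x ^ k)"
  shows "integrable M (\<lambda>x. (f x + g x) ^ k)"
proof (rule Bochner_Integration.integrable_bound)
  show "integrable M (\<lambda>x. 2 ^ k * (\<bar>f x ^ k\<bar> + \<bar>g x ^ k\<bar>))"
    using assms
    by (intro integrable_mult_right Bochner_Integration.integrable_add integrable_abs)
  have [measurable]: "f \<in> borel_measurable M" "g \<in> borel_measurable M"
    using assms[of 1] by auto
  show "(\<lambda>x. (f x + g x) ^ k) \<in> borel_measurable M" by simp
  have "\<bar>a + b\<bar> ^ k \<le> 2 ^ k * (\<bar>a\<bar> ^ k + \<bar>b\<bar> ^ k)" for a b :: real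
  proof -
    have "\<bar>a + b\<bar> ^ k \<le> (2 * max \<bar>a\<bar> \<bar>b\<bar>) ^ k"
      by (intro power_mono) auto
    also have "\<dots> \<le> 2 ^ k * (\<bar>a\<bar> ^ k + \<bar>b\<bar> ^ k)"
      by (auto simp: power_mult_distrib max_def)
    finally show ?thesis .
  qed
  then show "AE x in M. norm ((f x + g x) ^ k) \<le> norm (2 ^ k * (\<bar>f x ^ k\<bar> + \<bar>g x ^ k\<bar>))"
    by (simp add: power_abs)
qed

lemma integrable_all_powers_mult:
  fixes f g :: "'a \<Rightarrow> real"
  assumes "\<And>k. integrable M (\<lambda>x. f x ^ k)" "\<And>k. integrable M (\<lambda>x. g x ^ k)"
  shows "integrable M (\<lambda>x. (f x * g x) ^ k)"
proof (rule Bochner_Integration.integrable_bound)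
  \<comment> \<open>The dominating function comes from
    \<open>\<bar>a * b\<bar> \<le> a^2 + b^2\<close> with \<open>a = f x ^ k\<close> and
    \<open>b = g x ^ k\<close>; the doubled exponent is why a single power would not suffice as
    hypothesis.\<close>
  show "integrable M (\<lambda>x. f x ^ (k * 2) + g x ^ (k * 2))"
    using assms by (intro Bochner_Integration.integrable_add)
  have [measurable]: "f \<in> borel_measurable M" "g \<in> borel_measurable M"
    using assms[of 1] by auto
  show "(\<lambda>x. (f x * g x) ^ k) \<in> borel_measurable M" by simp
  have "\<bar>a * b\<bar> \<le> a\<^sup>2 + b\<^sup>2" for a b :: real
  proof -
    have "0 \<le> \<bar>a\<bar> * \<bar>b\<bar>" by simp
    then show ?thesis
      using sum_squares_bound[of "\<bar>a\<bar>" "\<bar>b\<bar>"] unfolding abs_mult power2_abs by linarith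
  qed
  then show "AE x in M. norm ((f x * g x) ^ k) \<le> norm (f x ^ (k * 2) + g x ^ (k * 2))"
    by (simp add: power_mult_distrib power_mult)
qed

section \<open>The standard Gaussian law and its moments\<close>

lemma measurable_vec_lambda:
  "(\<lambda>w. \<chi> i. w i) \<in> (\<Pi>\<^sub>M i\<in>(UNIV :: 'n::finite set). density lborel D) \<rightarrow>\<^sub>M
     (borel :: (real ^ 'n) measure)"
proof (subst borel_measurable_euclidean_space, rule ballI)
  fix e :: "real ^ 'n" assume "e \<in> Basis"
  then obtain i where "e = axis i 1" by (auto simp: Basis_vec_def)
  then show "(\<lambda>w. (\<chi> j. w j) \<bullet> e) \<in>
      borel_measurable (\<Pi>\<^sub>M i\<in>(UNIV :: 'n set). density lborel D)"
    using measurable_component_singleton[of i UNIV "\<lambda>i. density lborel D"]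
    by (simp add: inner_axis)
qed

lemma sets_std_normal_vec [simp, measurable_cong]: "sets std_normal_vec = sets borel"
  by (simp add: std_normal_vec_def)

lemma prob_space_std_normal_vec: "prob_space (std_normal_vec :: (real ^ 'n::finite) measure)"
  unfolding std_normal_vec_def
  by (intro prob_space.prob_space_distr prob_space_PiM prob_space_normal_density
      measurable_vec_lambda) simp

text \<open>The marginal of a product of probability measures is the corresponding factor, which
  reduces coordinate moments to one dimension.\<close>

lemma distr_component_std_normal_vec:
  "distr std_normal_vec borel (\<lambda>w. w $ i) = density lborel (\<lambda>t. ennreal (std_normal_density t))"
proof -
  let ?D = "density lborel (\<lambda>t. ennreal (std_normal_density t))"
  have "distr std_normal_vec borel (\<lambda>w. w $ i) =
      distr (\<Pi>\<^sub>M i\<in>(UNIV :: 'a set). ?D) borel (\<lambda>w. w i)"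
    unfolding std_normal_vec_def
    by (subst distr_distr[OF _ measurable_vec_lambda]) (auto simp: comp_def)
  \<comment> \<open>The target \<open>borel\<close> is replaced by \<open>?D\<close>, which has the
    same measurable sets, to match the form of \<open>distr_PiM_component\<close>.\<close>
  also have "\<dots> = distr (\<Pi>\<^sub>M i\<in>(UNIV :: 'a set). ?D) ?D (\<lambda>w. w i)"
    by (intro distr_cong) auto
  also have "\<dots> = ?D"
    by (intro distr_PiM_component prob_space_normal_density) auto
  finally show ?thesis .
qed

lemma integrable_component_power_std_normal_vec:
  "integrable std_normal_vec (\<lambda>w :: real ^ 'n::finite. (w $ i) ^ k)"
proof -
  have "integrable (distr std_normal_vec borel (\<lambda>w :: real ^ 'n. w $ i)) (\<lambda>t. t ^ k)"
    unfolding distr_component_std_normal_vec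
    by (subst integrable_density) (auto simp: integrable_std_normal_moment)
  then show ?thesis
    by (subst (asm) integrable_distr_eq) auto
qed

text \<open>Integrability alone is not preserved by products, hence the induction over all powers.\<close>

lemma integrable_power_polynomial_std_normal_vec:
  fixes p :: "real ^ 'n::finite \<Rightarrow> real"
  assumes "real_polynomial_function p"
  shows "integrable std_normal_vec (\<lambda>w. p w ^ k)"
  using assms
proof (induction p arbitrary: k)
  case (linear f)
  interpret bounded_linear f by fact
  interpret prob_space "std_normal_vec :: (real ^ 'n) measure" by (rule prob_space_std_normal_vec)
  \<comment> \<open>A linear functional is a finite combination of coordinates. The exponent stays
    general because the closure lemmas for sums and products ask for every power.\<close>
  have *: "integrable std_normal_vec (\<lambda>w :: real ^ 'n. (\<Sum>i\<in>I. w $ i * f (axis i 1)) ^ k)"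
    if "finite I" for I k
    using that
  proof (induction I arbitrary: k)
    case empty
    then show ?case by simp
  next
    case (insert i I)
    have "integrable std_normal_vec
        (\<lambda>w :: real ^ 'n. (w $ i * f (axis i 1) + (\<Sum>i\<in>I. w $ i * f (axis i 1))) ^ k)"
      by (intro integrable_all_powers_add insert.IH integrable_all_powers_mult
          integrable_component_power_std_normal_vec) simp
    then show ?case using insert.hyps by simp
  qed
  have f_eq: "f = (\<lambda>w. \<Sum>i\<in>UNIV. w $ i * f (axis i 1))"
  proof
    fix w :: "real ^ 'n"
    have "w = (\<Sum>i\<in>UNIV. w $ i *\<^sub>R axis i 1)"
      by (simp add: vec_eq_iff axis_def if_distrib cong: if_cong)
    then have "f w = f (\<Sum>i\<in>UNIV. w $ i *\<^sub>R axis i 1)" by simp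
    then show "f w = (\<Sum>i\<in>UNIV. w $ i * f (axis i 1))" by (simp add: sum scaleR)
  qed
  show ?case by (subst f_eq) (rule *[OF finite])
next
  case (const c)
  interpret prob_space "std_normal_vec :: (real ^ 'n) measure" by (rule prob_space_std_normal_vec)
  show ?case by simp
next
  case (add f g)
  then show ?case by (intro integrable_all_powers_add)
next
  case (mult f g)
  then show ?case by (intro integrable_all_powers_mult)
qed

text \<open>With states and input fixed, \<open>next_state\<close> is affine in the noise, so its
  composition with \<open>g\<close> is a polynomial in \<open>w\<close>.\<close>

lemma integrable_polynomial_next_state:
  assumes "real_polynomial_function g"
  shows "integrable std_normal_vec (\<lambda>w. g (next_state S x xh u w))"
proof -
  have "polynomial_function (next_state S x xh u)"
    unfolding next_state_def
    by (intro polynomial_function_add polynomial_function_const polynomial_function_bounded_linear)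
      (rule matrix_vector_mul_bounded_linear)
  then have "real_polynomial_function (g \<circ> next_state S x xh u)"
    using assms by (rule real_polynomial_function_compose)
  then show ?thesis
    using integrable_power_polynomial_std_normal_vec[of "g \<circ> next_state S x xh u" 1] by simp
qed

section \<open>The barrier along one step of the dynamics\<close>

text \<open>The shift moves \<open>x 0\<close> into the delayed part and pushes \<open>x h\<close>
  out of it, so only these two \<open>gt\<close> terms survive the comparison.\<close>

lemma barrier_successor:
  assumes "h \<ge> 1"
  shows "barrier h g gt (case_nat y x) = g y + barrier h g gt x - g (x 0) + gt (x 0) - gt (x h)"
proof -
  have "(\<Sum>i=1..h. gt (case_nat y x i)) = (\<Sum>i<h. gt (x i))"
    by (simp add: sum.atLeast1_atMost_eq)
  moreover have "gt (x 0) + (\<Sum>i=1..h. gt (x i)) = (\<Sum>i<Suc h. gt (x i))"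
    by (simp only: sum.lessThan_Suc_shift One_nat_def sum.atLeast1_atMost_eq)
  ultimately show ?thesis by (simp add: barrier_def)
qed

text \<open>Only the \<open>g\<close> term sees the noise; everything else is constant and has total
  mass one as its factor.\<close>

lemma expected_barrier_eq:
  assumes "delay S \<ge> 1" "real_polynomial_function g"
  shows "expected_barrier S g gt x u =
    (\<integral>w. g (next_state S (x 0) (x (delay S)) u w) \<partial>std_normal_vec)
    + barrier (delay S) g gt x - g (x 0) + gt (x 0) - gt (x (delay S))"
proof -
  interpret prob_space "std_normal_vec :: (real ^ 'a) measure" by (rule prob_space_std_normal_vec)
  let ?G = "\<lambda>w. g (next_state S (x 0) (x (delay S)) u w)"
  let ?c = "barrier (delay S) g gt x - g (x 0) + gt (x 0) - gt (x (delay S))"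
  have "expected_barrier S g gt x u = (\<integral>w. ?G w + ?c \<partial>std_normal_vec)"
    unfolding expected_barrier_def barrier_successor[OF assms(1)]
    by (simp add: algebra_simps)
  also have "\<dots> = (\<integral>w. ?G w \<partial>std_normal_vec) + ?c"
    using integrable_polynomial_next_state[OF assms(2)]
    by (subst Bochner_Integration.integral_add) (auto simp: prob_space)
  finally show ?thesis by simp
qed

text \<open>This links certificates involving one delayed state with weight \<open>h\<close> to the
  barrier, which sums over all \<open>h\<close> of them.\<close>

lemma barrier_average:
  "real h * barrier h g gt x = (\<Sum>i=1..h. g (x 0) + real h * gt (x i))"
  by (simp add: barrier_def sum.distrib sum_distrib_left algebra_simps)

text \<open>The bound on unsafe histories is stated under the inclusion of
  \<open>states S - Xb\<close> in the set where \<open>J - Jb\<close> is nonnegative: a point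
  outside \<open>Xb\<close> only has some negative component of \<open>Jb\<close>, which does not
  give \<open>J - Jb \<ge> 0\<close> in every component.\<close>

theorem lemma4p1:
  fixes S :: "('n::finite, 'm::finite) dt_snps_td"
    and N :: nat and b :: "nat \<Rightarrow> real ^ 'm"
    and J Jb :: "real ^ 'n \<Rightarrow> real ^ 'p" and Ja :: "real ^ 'n \<Rightarrow> real ^ 'a"
    and Xa Xb :: "(real ^ 'n) set"
    and g gt :: "real ^ 'n \<Rightarrow> real"
    and \<gamma>a \<gamma>b \<eta> :: real
    and Yu :: "(real ^ 'n) \<times> (real ^ 'n) \<Rightarrow> real ^ 'm"
    and Yt :: "nat \<Rightarrow> (real ^ 'n) \<times> (real ^ 'n) \<times> (real ^ 'm) \<Rightarrow> real"
    and Yj Yhj :: "nat \<Rightarrow> (real ^ 'n) \<times> (real ^ 'n) \<Rightarrow> real ^ 'p"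
    and Ya Ya' :: "real ^ 'n \<Rightarrow> real ^ 'a"
    and Yb Yb' :: "real ^ 'n \<Rightarrow> real ^ 'p"
    and Y Yh :: "(real ^ 'n) \<times> (real ^ 'n) \<times> (real ^ 'm) \<Rightarrow> real ^ 'p"
  assumes system: "is_dt_snps_td S"
    and input_set: "inputs S = {u. \<forall>j\<in>{1..N}. b j \<bullet> u \<le> 1}"
    and set_polys: "polynomial_function J" "polynomial_function Ja" "polynomial_function Jb"
    and state_set: "states S = {x. J x \<ge> 0}"
    and initial_set: "Xa = {x. Ja x \<ge> 0}" "Xa \<subseteq> states S"
    and unsafe_set: "Xb = {x. Jb x \<ge> 0}" "Xb \<subseteq> states S"
    and barrier_polys: "real_polynomial_function g" "real_polynomial_function gt"
    and barrier_sos: "sos_history (delay S) (barrier (delay S) g gt)"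
    and constants: "\<gamma>a > 0" "\<gamma>b > 0" "\<eta> > 0" "\<gamma>b > \<gamma>a"
    and controller_poly: "polynomial_function Yu"
    and sos_input_multipliers: "\<forall>j\<in>{1..N}. sos (Yt j) \<and> sos_vec (Yj j) \<and> sos_vec (Yhj j)"
    and sos_multipliers:
      "sos_vec Ya" "sos_vec Ya'" "sos_vec Yb" "sos_vec Yb'" "sos_vec Y" "sos_vec Yh"
    and sos_initial:
      "sos (\<lambda>(x, x'). - g x - real (delay S) * gt x' - Ya x \<bullet> Ja x - Ya' x' \<bullet> Ja x' + \<gamma>a)"
    and sos_unsafe:
      "sos (\<lambda>(x, x'). g x + real (delay S) * gt x' - Yb x \<bullet> Jb x - Yb' x' \<bullet> (J x' - Jb x') - \<gamma>b)"
    and sos_decrease: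
      "sos (\<lambda>(x, xh, u).
         - (\<integral>w. g (next_state S x xh u w) \<partial>std_normal_vec) + \<eta> + g x - gt x + gt xh
         - (\<Sum>q\<in>UNIV. u $ q - Yu (x, xh) $ q)
         - Y (x, xh, u) \<bullet> J x - Yh (x, xh, u) \<bullet> J xh
         - (\<Sum>j=1..N. (1 - b j \<bullet> u) * Yt j (x, xh, u)))"
    and sos_input:
      "\<forall>j\<in>{1..N}. sos (\<lambda>(x, xh). 1 - b j \<bullet> Yu (x, xh) - Yj j (x, xh) \<bullet> J x - Yhj j (x, xh) \<bullet> J xh)"
  shows
    "(\<forall>x. (\<forall>i\<le>delay S. x i \<in> Xa) \<longrightarrow> barrier (delay S) g gt x \<le> \<gamma>a) \<and>
     (states S - Xb \<subseteq> {x. J x - Jb x \<ge> 0} \<longrightarrow>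
        (\<forall>x. x 0 \<in> Xb \<and> (\<forall>i\<in>{1..delay S}. x i \<in> states S - Xb) \<longrightarrow>
           barrier (delay S) g gt x \<ge> \<gamma>b)) \<and>
     (\<forall>x. (\<forall>i\<le>delay S. x i \<in> states S) \<longrightarrow>
        (\<exists>u\<in>inputs S. expected_barrier S g gt x u - barrier (delay S) g gt x \<le> \<eta>)) \<and>
     (\<forall>x\<in>states S. \<forall>xh\<in>states S. Yu (x, xh) \<in> inputs S) \<and>
     (\<forall>x. (\<forall>i\<le>delay S. x i \<in> states S) \<longrightarrow>
        expected_barrier S g gt x (Yu (x 0, x (delay S))) - barrier (delay S) g gt x \<le> \<eta>)"
proof -
  let ?h = "delay S"
  have h: "?h \<ge> 1" using system by (simp add: is_dt_snps_td_def)
  have initial: "barrier ?h g gt x \<le> \<gamma>a" if x: "\<forall>i\<le>?h. x i \<in> Xa" for x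
  proof -
    have "g (x 0) + real ?h * gt (x i) \<le> \<gamma>a" if "i \<in> {1..?h}" for i
    proof -
      have "Ya (x 0) \<bullet> Ja (x 0) \<ge> 0" "Ya' (x i) \<bullet> Ja (x i) \<ge> 0"
        using x that initial_set(1)
        by (auto intro!: sos_multipliers[THEN sos_vec_inner_nonneg])
      then show ?thesis using sos_nonneg[OF sos_initial, of "(x 0, x i)"] by simp
    qed
    \<comment> \<open>Summing the \<open>?h\<close> bounds gives \<open>?h\<close> times the claim;
      the factor cancels since the delay is positive.\<close>
    then have "real ?h * barrier ?h g gt x \<le> real ?h * \<gamma>a"
      using sum_bounded_above[of "{1..?h}" "\<lambda>i. g (x 0) + real ?h * gt (x i)" \<gamma>a]
      unfolding barrier_average by simp
    then show ?thesis using h by simp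
  qed
  have unsafe: "barrier ?h g gt x \<ge> \<gamma>b"
    if sub: "states S - Xb \<subseteq> {x. J x - Jb x \<ge> 0}"
      and x0: "x 0 \<in> Xb" and x: "\<forall>i\<in>{1..?h}. x i \<in> states S - Xb" for x
  proof -
    have "g (x 0) + real ?h * gt (x i) \<ge> \<gamma>b" if "i \<in> {1..?h}" for i
    proof -
      \<comment> \<open>The inclusion gives the sign that makes the \<open>Yb'\<close> term of the
        certificate nonnegative.\<close>
      have "J (x i) - Jb (x i) \<ge> 0" using sub x that by blast
      then have "Yb (x 0) \<bullet> Jb (x 0) \<ge> 0" "Yb' (x i) \<bullet> (J (x i) - Jb (x i)) \<ge> 0"
        using x0 unsafe_set(1) by (auto intro!: sos_multipliers[THEN sos_vec_inner_nonneg])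
      then show ?thesis using sos_nonneg[OF sos_unsafe, of "(x 0, x i)"] by simp
    qed
    then have "real ?h * barrier ?h g gt x \<ge> real ?h * \<gamma>b"
      using sum_bounded_below[of "{1..?h}" \<gamma>b "\<lambda>i. g (x 0) + real ?h * gt (x i)"]
      unfolding barrier_average by simp
    then show ?thesis using h by simp
  qed
  have admissible: "Yu (x, xh) \<in> inputs S" if "x \<in> states S" "xh \<in> states S" for x xh
  proof -
    have "b j \<bullet> Yu (x, xh) \<le> 1" if j: "j \<in> {1..N}" for j
    proof -
      have "Yj j (x, xh) \<bullet> J x \<ge> 0" "Yhj j (x, xh) \<bullet> J xh \<ge> 0"
        using \<open>x \<in> states S\<close> \<open>xh \<in> states S\<close> state_set sos_input_multipliers j
        by (auto intro!: sos_vec_inner_nonneg[of "Yj j"] sos_vec_inner_nonneg[of "Yhj j"])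
      then show ?thesis using sos_nonneg[OF bspec[OF sos_input j], of "(x, xh)"] by simp
    qed
    then show ?thesis by (simp add: input_set)
  qed
  have decrease: "expected_barrier S g gt x (Yu (x 0, x ?h)) - barrier ?h g gt x \<le> \<eta>"
    if "\<forall>i\<le>?h. x i \<in> states S" for x
  proof -
    have x: "x 0 \<in> states S" "x ?h \<in> states S" using that by auto
    let ?u = "Yu (x 0, x ?h)"
    have "Y (x 0, x ?h, ?u) \<bullet> J (x 0) \<ge> 0" "Yh (x 0, x ?h, ?u) \<bullet> J (x ?h) \<ge> 0"
      using x state_set by (auto intro!: sos_multipliers[THEN sos_vec_inner_nonneg])
    moreover have "(\<Sum>j=1..N. (1 - b j \<bullet> ?u) * Yt j (x 0, x ?h, ?u)) \<ge> 0"
      using admissible[OF x] sos_input_multipliers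
      by (intro sum_nonneg mult_nonneg_nonneg) (auto simp: input_set sos_nonneg)
    \<comment> \<open>By \<open>expected_barrier_eq\<close> the barrier at \<open>x\<close> cancels,
      leaving exactly the \<open>g\<close> and \<open>gt\<close> terms of the certificate.\<close>
    ultimately show ?thesis
      using sos_nonneg[OF sos_decrease, of "(x 0, x ?h, ?u)"]
      by (simp add: expected_barrier_eq[OF h barrier_polys(1)])
  qed
  have exists: "\<exists>u\<in>inputs S. expected_barrier S g gt x u - barrier ?h g gt x \<le> \<eta>"
    if "\<forall>i\<le>?h. x i \<in> states S" for x
    using decrease[OF that] admissible that by blast
  show ?thesis by (intro conjI allI impI ballI; (elim conjE)?)
    (use initial unsafe admissible decrease exists in simp_all)
qed

end
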